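(* Let $(\Omega,\mathcal F,\mu)$ be a probability space, let $(\mathcal E,\mathcal D(\mathcal E))$ be a conservative symmetric Dirichlet form on $L^2(\mu)$, let $p\in[1,2]$, and let $\beta:(0,\infty)\to[0,\infty)$ be a function. Assume that $$\Psi_p(f)\le\beta(r)\,\mathcal E(f,f)+r\,\mathrm{Osc}(f)^2,\qquad r>0,$$ for every bounded non-negative $f\in\mathcal D(\mathcal E)$. Then, for every $1\le q\le p$ and every bounded non-negative $f\in\mathcal D(\mathcal E)$, $$\Psi_q(f)\le\beta(r)\,\mathcal E(f,f)+r\,\mathrm{Osc}(f)^2,\qquad r>0,$$ with exactly the same function $\beta$.
   Context: A symmetric Dirichlet form $(\mathcal E,\mathcal D(\mathcal E))$ on $L^2(\mu)$ is called conservative if $1\in\mathcal D(\mathcal E)$ and $\mathcal E(1,1)=0$. For a non-negative $f\in L^2(\mu)$ and $1\le p<2$, with $\mu(g):=\int g\,d\mu$, $$\Psi_p(f):=\frac{\mu(f^2)-\mu(f^p)^{2/p}}{2-p},$$ and $\Psi_2(f):=\tfrac12\mathrm{Ent}_\mu(f^2)$, where $\mathrm{Ent}_\mu(f^2)=\mu(f^2\log f^2)-\mu(f^2)\log\mu(f^2)$ (convention $0\log 0=0$). For bounded $f$, $\mathrm{Osc}(f):=\operatorname{ess\,sup}f-\operatorname{ess\,inf}f$ (with respect to $\mu$). *)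

theory Defs
  imports "HOL-Probability.Probability"
begin

text \<open>
  Elements of \<open>L\<^sup>2(\<mu>)\<close> are handled through representatives: square integrable
  measurable functions, with \<open>\<mu>\<close>-almost everywhere equal functions identified. Accordingly,
  pointwise properties of elements of \<open>L\<^sup>2(\<mu>)\<close> (bounds, signs) are stated almost everywhere,
  and the form domain and the form below are required to respect the identification.
\<close>

definition L2_space :: "'a measure \<Rightarrow> ('a \<Rightarrow> real) set" where
  "L2_space M = {f \<in> borel_measurable M. integrable M (\<lambda>x. (f x)\<^sup>2)}"

text \<open>
  The axioms: \<open>D\<close> is a dense linear subspace of \<open>L\<^sup>2(\<mu>)\<close>; \<open>E\<close> is a symmetric non-negative
  bilinear form on \<open>D\<close>; the form is closed, that is, \<open>D\<close> is complete for
  \<open>E\<^sub>1(f,f) = E(f,f) + \<mu>(f\<^sup>2)\<close>; the unit contraction operates (Markov property).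
  The values of \<open>E\<close> outside \<open>D \<times> D\<close> are irrelevant.
\<close>

locale symmetric_Dirichlet_form =
  fixes M :: "'a measure"
    and D :: "('a \<Rightarrow> real) set"
    and E :: "('a \<Rightarrow> real) \<Rightarrow> ('a \<Rightarrow> real) \<Rightarrow> real"
  assumes dom_L2: "D \<subseteq> L2_space M"
    and dom_AE_cong:
      "\<And>f g. f \<in> D \<Longrightarrow> g \<in> borel_measurable M \<Longrightarrow> (AE x in M. f x = g x) \<Longrightarrow> g \<in> D"
    and dom_add: "\<And>f g. f \<in> D \<Longrightarrow> g \<in> D \<Longrightarrow> (\<lambda>x. f x + g x) \<in> D"
    and dom_scale: "\<And>c f. f \<in> D \<Longrightarrow> (\<lambda>x. c * f x) \<in> D"
    and dom_dense:
      "\<And>f e. f \<in> L2_space M \<Longrightarrow> e > 0 \<Longrightarrow> \<exists>g\<in>D. (\<integral>x. (f x - g x)\<^sup>2 \<partial>M) < e"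
    and form_AE_cong:
      "\<And>f g h. f \<in> D \<Longrightarrow> g \<in> D \<Longrightarrow> h \<in> D \<Longrightarrow> (AE x in M. f x = g x) \<Longrightarrow> E f h = E g h"
    and form_sym: "\<And>f g. f \<in> D \<Longrightarrow> g \<in> D \<Longrightarrow> E f g = E g f"
    and form_add:
      "\<And>f g h. f \<in> D \<Longrightarrow> g \<in> D \<Longrightarrow> h \<in> D \<Longrightarrow> E (\<lambda>x. f x + g x) h = E f h + E g h"
    and form_scale: "\<And>c f g. f \<in> D \<Longrightarrow> g \<in> D \<Longrightarrow> E (\<lambda>x. c * f x) g = c * E f g"
    and form_nonneg: "\<And>f. f \<in> D \<Longrightarrow> E f f \<ge> 0"
    and form_closed:
      "\<And>u :: nat \<Rightarrow> 'a \<Rightarrow> real.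
         (\<And>n. u n \<in> D) \<Longrightarrow>
         (\<And>e. e > 0 \<Longrightarrow> \<exists>N. \<forall>m\<ge>N. \<forall>n\<ge>N.
            E (\<lambda>x. u m x - u n x) (\<lambda>x. u m x - u n x) + (\<integral>x. (u m x - u n x)\<^sup>2 \<partial>M) < e) \<Longrightarrow>
         \<exists>v\<in>D. (\<lambda>n. E (\<lambda>x. u n x - v x) (\<lambda>x. u n x - v x)
                      + (\<integral>x. (u n x - v x)\<^sup>2 \<partial>M)) \<longlonglongrightarrow> 0"
    and dom_Markov: "\<And>f. f \<in> D \<Longrightarrow> (\<lambda>x. min (max 0 (f x)) 1) \<in> D"
    and form_Markov:
      "\<And>f. f \<in> D \<Longrightarrow>
         E (\<lambda>x. min (max 0 (f x)) 1) (\<lambda>x. min (max 0 (f x)) 1) \<le> E f f"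

locale conservative_symmetric_Dirichlet_form = symmetric_Dirichlet_form +
  assumes one_in_dom: "(\<lambda>x. 1) \<in> D"
    and form_one: "E (\<lambda>x. 1) (\<lambda>x. 1) = 0"

definition ess_bounded :: "'a measure \<Rightarrow> ('a \<Rightarrow> real) \<Rightarrow> bool" where
  "ess_bounded M f \<longleftrightarrow> (\<exists>C. AE x in M. \<bar>f x\<bar> \<le> C)"

definition essinf :: "'a measure \<Rightarrow> ('a \<Rightarrow> ereal) \<Rightarrow> ereal" where
  "essinf M f = - esssup M (\<lambda>x. - f x)"

text \<open>
  \<open>esssup\<close> takes values in a complete lattice, hence the passage through \<open>ereal\<close>; for bounded
  \<open>f\<close> on a probability space both terms are finite.
\<close>

definition Osc :: "'a measure \<Rightarrow> ('a \<Rightarrow> real) \<Rightarrow> real" where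
  "Osc M f = real_of_ereal (esssup M (\<lambda>x. ereal (f x)) - essinf M (\<lambda>x. ereal (f x)))"

text \<open>
  \<open>Ent M g\<close> is the entropy of a non-negative \<open>g\<close>. The convention \<open>0 log 0 = 0\<close> holds
  automatically. As Bochner integrals of non-integrable functions are \<open>0\<close>, this is meaningful
  only when \<open>g log g\<close> is integrable, e.g. for bounded \<open>g\<close> on a probability space.
\<close>

definition Ent :: "'a measure \<Rightarrow> ('a \<Rightarrow> real) \<Rightarrow> real" where
  "Ent M g = (\<integral>x. g x * ln (g x) \<partial>M) - (\<integral>x. g x \<partial>M) * ln (\<integral>x. g x \<partial>M)"

definition Psi :: "real \<Rightarrow> 'a measure \<Rightarrow> ('a \<Rightarrow> real) \<Rightarrow> real" where
  "Psi p M f =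
     (if p = 2 then Ent M (\<lambda>x. (f x)\<^sup>2) / 2
      else ((\<integral>x. (f x)\<^sup>2 \<partial>M) - (\<integral>x. f x powr p \<partial>M) powr (2 / p)) / (2 - p))"

end

theory Submission
  imports Defs
begin

text \<open>
  Adding a constant \<open>c \<ge> 0\<close> to \<open>f\<close> changes neither \<open>E(f,f)\<close> (the form is conservative) nor
  \<open>Osc(f)\<close>, so the hypothesis bounds \<open>\<Psi>\<^sub>p(f + c)\<close> for all \<open>c \<ge> 0\<close> at once. It therefore
  suffices that for \<open>1 < q < p\<close> some \<open>c \<ge> 0\<close> satisfies \<open>\<Psi>\<^sub>q(f) \<le> \<Psi>\<^sub>p(f + c)\<close>
  (\<open>Psi_le_Psi_shift\<close>). The shift cannot be dispensed with: in general
  \<open>\<Psi>\<^sub>q(f) \<le> \<Psi>\<^sub>p(f)\<close> fails, for instance for indicators of large sets.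

  To compare \<open>\<Psi>\<^sub>q\<close> and \<open>\<Psi>\<^sub>p\<close>, linearise the norm: for every \<open>N > 0\<close>, Bernoulli's
  inequality gives \<open>\<Psi>\<^sub>q(f) \<le> N\<^sup>2 \<integral> gap\<^sub>q(f / N) d\<mu>\<close>
  with an explicit function \<open>gap\<^sub>q\<close> of one variable (\<open>Psi_le_integral_gap\<close>), and for \<open>\<Psi>\<^sub>p\<close>
  there is equality when \<open>N\<close> is the \<open>L\<^sup>p\<close> norm (\<open>Psi_eq_integral_gap\<close>). The kernels satisfy
  \<open>a\<^sup>2 gap\<^sub>q(z) \<le> gap\<^sub>p(1 - a + a z)\<close> for \<open>a = (q - 1) / (p - 1)\<close> and \<open>z \<ge> 0\<close>
  (\<open>gap_comparison\<close>). If \<open>c = (1 - a) N\<close> with \<open>N = \<parallel>f + c\<parallel>\<^sub>p\<close> and \<open>z = f / (a N)\<close>, then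
  \<open>1 - a + a z = (f + c) / N\<close>, and integrating the comparison yields the claim. Such a \<open>c\<close> exists
  by the intermediate value theorem (\<open>ex_shift_eq_Lp_norm\<close>).

  For \<open>q = 1\<close> the shift would have to be infinite, as \<open>a = 0\<close>; this case follows from those with
  \<open>q > 1\<close> by continuity of \<open>\<Psi>\<^sub>q(f)\<close> as \<open>q\<close> decreases to \<open>1\<close>.
\<close>

section \<open>Functions with a critical point at 1\<close>

text \<open>
  All the functions of one variable below are normalised at \<open>1\<close>, and their signs have to be found on
  both sides of it; this form of the mean value theorem avoids distinguishing the two sides.
\<close>

lemma mean_value_from_one:
  fixes G :: "real \<Rightarrow> real"
  assumes "continuous_on (closed_segment 1 z) G"
    and "\<And>t. t \<in> open_segment 1 z \<Longrightarrow> (G has_real_derivative G' t) (at t)"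
    and "z \<noteq> 1"
  obtains t where "t \<in> open_segment 1 z" "G z - G 1 = (z - 1) * G' t"
proof (cases "1 < z")
  case True
  have "\<exists>l t. 1 < t \<and> t < z \<and> DERIV G t :> l \<and> G z - G 1 = (z - 1) * l"
    using assms True
    by (intro MVT)
      (auto simp: closed_segment_eq_real_ivl open_segment_eq_real_ivl real_differentiable_def)
  then obtain l t where "1 < t" "t < z" "DERIV G t :> l" "G z - G 1 = (z - 1) * l"
    by blast
  moreover from this have "l = G' t"
    using assms(2)[of t] True by (auto simp: open_segment_eq_real_ivl intro: DERIV_unique)
  ultimately show ?thesis
    using True that[of t] by (auto simp: open_segment_eq_real_ivl)
next
  case False
  then have z: "z < 1" using assms(3) by simp
  have "\<exists>l t. z < t \<and> t < 1 \<and> DERIV G t :> l \<and> G 1 - G z = (1 - z) * l"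
    using assms z
    by (intro MVT)
      (auto simp: closed_segment_eq_real_ivl open_segment_eq_real_ivl real_differentiable_def)
  then obtain l t where "z < t" "t < 1" "DERIV G t :> l" "G 1 - G z = (1 - z) * l"
    by blast
  moreover from this have "l = G' t"
    using assms(2)[of t] z by (auto simp: open_segment_eq_real_ivl intro: DERIV_unique)
  ultimately show ?thesis
    using z that[of t] by (auto simp: open_segment_eq_real_ivl algebra_simps)
qed

lemma nonneg_if_critical_at_one:
  fixes G :: "real \<Rightarrow> real"
  assumes "continuous_on (closed_segment 1 z) G"
    and "\<And>t. t \<in> open_segment 1 z \<Longrightarrow> (G has_real_derivative G' t) (at t)"
    and "\<And>t. t \<in> open_segment 1 z \<Longrightarrow> 0 \<le> (t - 1) * G' t"
    and "G 1 = 0"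
  shows "0 \<le> G z"
proof (cases "z = 1")
  case False
  obtain t where t: "t \<in> open_segment 1 z" "G z - G 1 = (z - 1) * G' t"
    using mean_value_from_one[OF assms(1,2) False] by blast
  have "0 \<le> (z - 1) * G' t"
    using assms(3)[OF t(1)] t(1) False
    by (auto simp: open_segment_eq_real_ivl zero_le_mult_iff split: if_splits)
  then show ?thesis using t(2) assms(4) by simp
qed (simp add: assms)

lemma Bernoulli_powr:
  fixes t r :: real
  assumes "0 \<le> t" "1 \<le> r"
  shows "1 + r * (t - 1) \<le> t powr r"
proof -
  have "0 \<le> t powr r - 1 - r * (t - 1)"
  proof (rule nonneg_if_critical_at_one[where z = t
        and G = "\<lambda>t. t powr r - 1 - r * (t - 1)" and G' = "\<lambda>t. r * (t powr (r - 1) - 1)"])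
    show "continuous_on (closed_segment 1 t) (\<lambda>t. t powr r - 1 - r * (t - 1))"
      using assms
      by (intro continuous_intros continuous_on_powr')
        (auto simp: closed_segment_eq_real_ivl split: if_splits)
  next
    fix s assume "s \<in> open_segment 1 t"
    then have s: "0 < s" using assms by (auto simp: open_segment_eq_real_ivl split: if_splits)
    show "((\<lambda>t. t powr r - 1 - r * (t - 1)) has_real_derivative r * (s powr (r - 1) - 1)) (at s)"
      using s by (auto intro!: derivative_eq_intros simp: algebra_simps)
    show "0 \<le> (s - 1) * (r * (s powr (r - 1) - 1))"
    proof (cases "1 \<le> s")
      case True
      then have "1 \<le> s powr (r - 1)" using assms by (intro ge_one_powr_ge_zero) auto
      then show ?thesis using True assms by simp
    next
      case False
      then have "s powr (r - 1) \<le> 1" using assms s by (intro powr_le1) auto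
      then show ?thesis using False assms by (simp add: mult_nonpos_nonpos mult_nonneg_nonpos)
    qed
  qed simp
  then show ?thesis by simp
qed

section \<open>The kernels\<close>

text \<open>
  For \<open>p < 2\<close> this is the integrand of the deficit \<open>(\<mu>(f\<^sup>2) - m\<^bsup>2/p\<^esup>) / (2 - p)\<close>, where
  \<open>m = \<mu>(f\<^sup>p)\<close>, after the convex function \<open>m\<^bsup>2/p\<^esup>\<close> has been replaced by its tangent at \<open>m = 1\<close>;
  the formula for \<open>p = 2\<close> is the limit as \<open>p\<close> tends to \<open>2\<close>.
\<close>

definition gap :: "real \<Rightarrow> real \<Rightarrow> real" where
  "gap p x = (if p = 2 then x\<^sup>2 * ln x - (x\<^sup>2 - 1) / 2
              else (x\<^sup>2 - 1) / (2 - p) - 2 * (x powr p - 1) / (p * (2 - p)))"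

definition gap' :: "real \<Rightarrow> real \<Rightarrow> real" where
  "gap' p x = (if p = 2 then 2 * x * ln x else (2 * x - 2 * x powr (p - 1)) / (2 - p))"

definition gap'' :: "real \<Rightarrow> real \<Rightarrow> real" where
  "gap'' p x = (if p = 2 then 2 * ln x + 2 else (2 - 2 * (p - 1) * x powr (p - 2)) / (2 - p))"

lemma gap_at_one: "gap p 1 = 0" "gap' p 1 = 0" "p \<le> 2 \<Longrightarrow> gap'' p 1 = 2"
  by (auto simp: gap_def gap'_def gap''_def field_simps)

text \<open>
  The first two derivatives still need a separate formula for \<open>p = 2\<close>. The third does not, which
  is why comparisons of kernels with different exponents start from the third derivative.
\<close>

lemma gap_deriv:
  assumes "0 < x" "1 \<le> p" "p \<le> 2"
  shows "(gap p has_real_derivative gap' p x) (at x)"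
proof (cases "p = 2")
  case True
  have "((\<lambda>x. x\<^sup>2 * ln x - (x\<^sup>2 - 1) / 2) has_real_derivative 2 * x * ln x) (at x)"
    using assms by (auto intro!: derivative_eq_intros simp: power2_eq_square field_simps)
  then show ?thesis using True by (simp add: gap_def[abs_def] gap'_def)
next
  case False
  have "((\<lambda>x. x\<^sup>2 - 1) has_real_derivative 2 * x) (at x)"
    "((\<lambda>x. 2 * (x powr p - 1)) has_real_derivative 2 * (p * x powr (p - 1))) (at x)"
    using assms by (auto intro!: derivative_eq_intros)
  then have "((\<lambda>x. (x\<^sup>2 - 1) / (2 - p) - 2 * (x powr p - 1) / (p * (2 - p))) has_real_derivative
      2 * x / (2 - p) - 2 * (p * x powr (p - 1)) / (p * (2 - p))) (at x)"
    by (intro DERIV_diff DERIV_cdivide)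
  also have "2 * x / (2 - p) - 2 * (p * x powr (p - 1)) / (p * (2 - p)) =
      (2 * x - 2 * x powr (p - 1)) / (2 - p)"
    using assms by (simp add: diff_divide_distrib)
  finally have "((\<lambda>x. (x\<^sup>2 - 1) / (2 - p) - 2 * (x powr p - 1) / (p * (2 - p))) has_real_derivative
      (2 * x - 2 * x powr (p - 1)) / (2 - p)) (at x)" .
  then show ?thesis using False by (simp add: gap_def[abs_def] gap'_def)
qed

lemma gap'_deriv:
  assumes "0 < x" "1 \<le> p" "p \<le> 2"
  shows "(gap' p has_real_derivative gap'' p x) (at x)"
proof (cases "p = 2")
  case True
  have "((\<lambda>x. 2 * x * ln x) has_real_derivative 2 * ln x + 2) (at x)"
    using assms by (auto intro!: derivative_eq_intros simp: field_simps)
  then show ?thesis using True by (simp add: gap'_def[abs_def] gap''_def)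
next
  case False
  have "((\<lambda>x. (2 * x - 2 * x powr (p - 1)) / (2 - p)) has_real_derivative
      (2 - 2 * (p - 1) * x powr (p - 2)) / (2 - p)) (at x)"
    using assms by (intro DERIV_cdivide) (auto intro!: derivative_eq_intros)
  then show ?thesis using False by (simp add: gap'_def[abs_def] gap''_def)
qed

lemma gap''_deriv:
  assumes "0 < x" "1 \<le> p" "p \<le> 2"
  shows "(gap'' p has_real_derivative 2 * (p - 1) * x powr (p - 3)) (at x)"
proof (cases "p = 2")
  case True
  have "((\<lambda>x. 2 * ln x + 2) has_real_derivative 2 / x) (at x)"
    using assms by (auto intro!: derivative_eq_intros simp: field_simps)
  then show ?thesis using True assms by (simp add: gap''_def[abs_def] powr_minus_divide)
next
  case False
  have "((\<lambda>x. (2 - 2 * (p - 1) * x powr (p - 2)) / (2 - p)) has_real_derivative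
      (2 * (p - 1) * (2 - p) * x powr (p - 3)) / (2 - p)) (at x)"
    using assms by (intro DERIV_cdivide) (auto intro!: derivative_eq_intros simp: algebra_simps)
  then show ?thesis using False by (simp add: gap''_def[abs_def])
qed

text \<open>
  The point \<open>0\<close> matters because \<open>f\<close> may vanish. For \<open>p = 2\<close> the kernel is only evaluated
  at shifted functions, whose values are bounded away from \<open>0\<close>.
\<close>

lemma continuous_on_gap:
  assumes "1 \<le> p" "p \<le> 2" "p < 2 \<and> 0 \<le> l \<or> 0 < l"
  shows "continuous_on {l..} (gap p)"
proof (cases "p = 2")
  case True
  then show ?thesis using assms
    by (auto intro!: continuous_intros simp: gap_def[abs_def])
next
  case False
  then show ?thesis using assms
    by (auto intro!: continuous_intros continuous_on_powr' simp: gap_def[abs_def])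
qed

text \<open>
  Both sides and their first two derivatives agree at \<open>z = 1\<close>. The difference of the third
  derivatives is a positive multiple of \<open>x\<^bsup>p-3\<^esup> - z\<^bsup>q-3\<^esup>\<close> with \<open>x = 1 - a + a z\<close>; this is where
  \<open>a (p - 1) = q - 1\<close> enters. As \<open>x\<close> lies between \<open>1\<close> and \<open>z\<close> and \<open>q - 3 < p - 3 < 0\<close>, it has the
  sign of \<open>z - 1\<close>. So the difference of the second derivatives is minimal, with value \<open>0\<close>, at
  \<open>z = 1\<close>: the difference of the two sides is convex with a critical zero at \<open>1\<close>.
\<close>

lemma gap_comparison:
  assumes q: "1 < q" and qp: "q < p" and p: "p \<le> 2" and z: "0 \<le> z"
  defines "a \<equiv> (q - 1) / (p - 1)"
  shows "a\<^sup>2 * gap q z \<le> gap p (1 - a + a * z)"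
proof -
  have a: "0 < a" "a < 1" and ap: "a * (p - 1) = q - 1"
    using q qp by (auto simp: a_def)
  define X where "X t = 1 - a + a * t" for t
  have X_pos: "0 < X t" if "0 \<le> t" for t
    using a that by (auto simp: X_def intro: add_pos_nonneg)
  have X_deriv: "(X has_real_derivative a) (at t)" for t
    unfolding X_def[abs_def] by (auto intro!: derivative_eq_intros)
  have X1: "X 1 = 1" by (simp add: X_def)
  define G where "G t = gap p (X t) - a\<^sup>2 * gap q t" for t
  define G1 where "G1 t = a * gap' p (X t) - a\<^sup>2 * gap' q t" for t
  define G2 where "G2 t = gap'' p (X t) - gap'' q t" for t
  define G3 where "G3 t = 2 * (q - 1) * (X t powr (p - 3) - t powr (q - 3))" for t
  have G: "(G has_real_derivative G1 t) (at t)" if "0 < t" for t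
    unfolding G_def[abs_def] G1_def using that X_pos[of t] q qp p
    by (auto intro!: derivative_eq_intros DERIV_chain2[OF gap_deriv X_deriv] gap_deriv)
  have G1: "(G1 has_real_derivative a\<^sup>2 * G2 t) (at t)" if "0 < t" for t
    unfolding G1_def[abs_def] G2_def using that X_pos[of t] q qp p
    by (auto intro!: derivative_eq_intros DERIV_chain2[OF gap'_deriv X_deriv] gap'_deriv
        simp: power2_eq_square algebra_simps)
  have G2: "(G2 has_real_derivative G3 t) (at t)" if "0 < t" for t
  proof -
    have "(G2 has_real_derivative 2 * (p - 1) * X t powr (p - 3) * a - 2 * (q - 1) * t powr (q - 3)) (at t)"
      unfolding G2_def[abs_def] using that X_pos[of t] q qp p
      by (intro DERIV_diff DERIV_chain2[OF gap''_deriv X_deriv] gap''_deriv) auto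
    also have "2 * (p - 1) * X t powr (p - 3) * a = 2 * (a * (p - 1)) * X t powr (p - 3)"
      by simp
    finally show ?thesis unfolding ap by (simp add: G3_def right_diff_distrib)
  qed
  have at1: "G 1 = 0" "G1 1 = 0" "G2 1 = 0"
    using qp p by (auto simp: G_def G1_def G2_def X1 gap_at_one)
  have G3: "0 \<le> (t - 1) * G3 t" if t: "0 < t" for t
  proof (cases "1 \<le> t")
    case True
    then have "a * 1 \<le> a * t" "(1 - a) * 1 \<le> (1 - a) * t"
      using a by (auto intro: mult_left_mono)
    then have "X t \<le> t" by (simp add: X_def algebra_simps)
    have "t powr (q - 3) \<le> t powr (p - 3)"
      using True qp by (intro powr_mono) auto
    also have "\<dots> \<le> X t powr (p - 3)"
      using \<open>X t \<le> t\<close> X_pos[of t] p t by (intro powr_mono2') auto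
    finally show ?thesis using True q by (simp add: G3_def)
  next
    case False
    then have "a * t \<le> a * 1" "(1 - a) * t \<le> (1 - a) * 1"
      using a by (auto intro!: mult_left_mono)
    then have "t \<le> X t" by (simp add: X_def algebra_simps)
    have "X t powr (p - 3) \<le> t powr (p - 3)"
      using \<open>t \<le> X t\<close> p t by (intro powr_mono2') auto
    also have "\<dots> \<le> t powr (q - 3)"
      using False qp t by (intro powr_mono') auto
    finally show ?thesis using False q
      by (simp add: G3_def mult_nonpos_nonpos mult_nonneg_nonpos)
  qed
  have seg_pos: "0 < s" if "s \<in> open_segment 1 t" "0 \<le> t" for s t :: real
    using that by (auto simp: open_segment_eq_real_ivl split: if_splits)
  have cseg_pos: "0 < s" if "s \<in> closed_segment 1 t" "0 < t" for s t :: real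
    using that by (auto simp: closed_segment_eq_real_ivl split: if_splits)
  have G2_nonneg: "0 \<le> G2 t" if t: "0 < t" for t
  proof (rule nonneg_if_critical_at_one[where G = G2 and G' = G3])
    show "continuous_on (closed_segment 1 t) G2"
      using cseg_pos[OF _ t] by (rule DERIV_continuous_on[OF has_field_derivative_at_within[OF G2]])
  qed (use t seg_pos in \<open>auto intro!: at1 G2 G3\<close>)
  have G1_sign: "0 \<le> (t - 1) * G1 t" if t: "0 < t" for t
  proof (cases "t = 1")
    case False
    have "continuous_on (closed_segment 1 t) G1"
      using cseg_pos[OF _ t] by (rule DERIV_continuous_on[OF has_field_derivative_at_within[OF G1]])
    then obtain s where s: "s \<in> open_segment 1 t" "G1 t - G1 1 = (t - 1) * (a\<^sup>2 * G2 s)"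
      using mean_value_from_one[of t G1 "\<lambda>t. a\<^sup>2 * G2 t"] G1[OF seg_pos] t False
      by (metis less_imp_le)
    have "(t - 1) * G1 t = (t - 1)\<^sup>2 * (a\<^sup>2 * G2 s)"
      using s(2) by (simp add: at1 power2_eq_square)
    then show ?thesis using G2_nonneg seg_pos s(1) t by (simp add: less_imp_le)
  qed simp
  have "continuous_on {0..} G"
  proof -
    have "continuous_on {0..} (\<lambda>t. gap p (X t))"
      using a q qp p
      by (intro continuous_on_compose2[OF continuous_on_gap[of p "1 - a"]])
        (auto simp: X_def[abs_def] intro!: continuous_intros)
    then show ?thesis
      unfolding G_def[abs_def] using q qp p
      by (intro continuous_intros continuous_on_gap) auto
  qed
  then have "continuous_on (closed_segment 1 z) G"
    by (rule continuous_on_subset) (use z in \<open>auto simp: closed_segment_eq_real_ivl split: if_splits\<close>)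
  then have "0 \<le> G z"
    using z seg_pos G G1_sign
    by (intro nonneg_if_critical_at_one[where G = G and G' = G1] at1) auto
  then show ?thesis by (simp add: G_def X_def)
qed

section \<open>Linearisation of the functional\<close>

lemma (in prob_space) integrable_continuous_bounded:
  fixes h f :: "_ \<Rightarrow> real"
  assumes [measurable]: "f \<in> borel_measurable M" and h[measurable]: "h \<in> borel_measurable borel"
    and cont: "continuous_on {l..C} h"
    and bd: "AE x in M. l \<le> f x \<and> f x \<le> C"
  shows "integrable M (\<lambda>x. h (f x))"
proof -
  have "compact (h ` {l..C})"
    by (intro compact_continuous_image cont) simp
  then obtain B where B: "\<And>y. y \<in> {l..C} \<Longrightarrow> \<bar>h y\<bar> \<le> B"
    unfolding compact_eq_bounded_closed bounded_real by blast
  show ?thesis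
  proof (rule integrable_const_bound[where B = B])
    show "AE x in M. norm (h (f x)) \<le> B" using bd by eventually_elim (auto intro: B)
  qed simp
qed

lemma (in prob_space) integrable_powr_bounded:
  fixes f :: "_ \<Rightarrow> real"
  assumes "f \<in> borel_measurable M" "AE x in M. 0 \<le> f x \<and> f x \<le> C" "1 \<le> p"
  shows "integrable M (\<lambda>x. f x powr p)"
  using assms
  by (intro integrable_continuous_bounded[of f "\<lambda>y. y powr p" 0 C])
    (auto intro!: continuous_intros continuous_on_powr')

lemma (in prob_space) integral_gap:
  fixes f :: "_ \<Rightarrow> real"
  assumes "f \<in> borel_measurable M" "AE x in M. 0 \<le> f x \<and> f x \<le> C"
    and q: "1 \<le> q" "q < 2" and N: "0 < N"
  shows "N\<^sup>2 * (\<integral>x. gap q (f x / N) \<partial>M) =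
    ((\<integral>x. (f x)\<^sup>2 \<partial>M) - N\<^sup>2 * (1 + (2 / q) * ((\<integral>x. f x powr q \<partial>M) / N powr q - 1))) / (2 - q)"
proof -
  have [simp]: "integrable M (\<lambda>x. f x powr q)"
    using integrable_powr_bounded assms by blast
  have [simp]: "integrable M (\<lambda>x. (f x)\<^sup>2)"
    using assms by (intro integrable_continuous_bounded[of f "\<lambda>y. y\<^sup>2" 0 C]) (auto intro!: continuous_intros)
  have "(\<integral>x. gap q (f x / N) \<partial>M) =
      (\<integral>x. (f x)\<^sup>2 / (N\<^sup>2 * (2 - q)) - f x powr q * (2 / (q * (2 - q) * N powr q)) + (2 / q - 1) / (2 - q) \<partial>M)"
  proof (rule integral_cong_AE)
    show "AE x in M. gap q (f x / N) = (f x)\<^sup>2 / (N\<^sup>2 * (2 - q))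
        - f x powr q * (2 / (q * (2 - q) * N powr q)) + (2 / q - 1) / (2 - q)"
      using assms(2)
    proof eventually_elim
      case (elim x)
      then have "(f x / N) powr q = f x powr q / N powr q" using N by (simp add: powr_divide)
      then have "gap q (f x / N) = ((f x)\<^sup>2 / N\<^sup>2 - 1) / (2 - q)
         - 2 * (f x powr q / N powr q - 1) / (q * (2 - q))"
        using q by (simp add: gap_def power_divide)
      then show ?case by (simp add: diff_divide_distrib right_diff_distrib left_diff_distrib ac_simps)
    qed
  qed (use assms(1) in \<open>auto simp: gap_def[abs_def]\<close>)
  also have "\<dots> = (\<integral>x. (f x)\<^sup>2 \<partial>M) / (N\<^sup>2 * (2 - q))
      - (\<integral>x. f x powr q \<partial>M) * (2 / (q * (2 - q) * N powr q)) + (2 / q - 1) / (2 - q)"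
    by (simp add: prob_space)
  also have "N\<^sup>2 * \<dots> = ((\<integral>x. (f x)\<^sup>2 \<partial>M)
      - N\<^sup>2 * ((2 / q) * ((\<integral>x. f x powr q \<partial>M) / N powr q)) + N\<^sup>2 * (2 / q - 1)) / (2 - q)"
  proof -
    have "N\<^sup>2 * (A / (N\<^sup>2 * d) - m * (2 / (q * d * Y)) + (2 / q - 1) / d) =
        (A - N\<^sup>2 * ((2 / q) * (m / Y)) + N\<^sup>2 * (2 / q - 1)) / d" for A m Y d :: real
      using N by (simp add: ring_distribs add_divide_distrib diff_divide_distrib ac_simps)
    then show ?thesis .
  qed
  finally show ?thesis by (simp add: algebra_simps)
qed

text \<open>
  Only the norm term is not linear in the law of \<open>f\<close>; the power \<open>2/q \<ge> 1\<close> being convex, it lies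
  above its tangent at \<open>N\<^sup>q\<close>.
\<close>

lemma (in prob_space) Psi_le_integral_gap:
  fixes f :: "_ \<Rightarrow> real"
  assumes "f \<in> borel_measurable M" "AE x in M. 0 \<le> f x \<and> f x \<le> C"
    and q: "1 \<le> q" "q < 2" and N: "0 < N"
  shows "Psi q M f \<le> N\<^sup>2 * (\<integral>x. gap q (f x / N) \<partial>M)"
proof -
  let ?m = "\<integral>x. f x powr q \<partial>M"
  have m: "0 \<le> ?m" by simp
  have "N\<^sup>2 * (1 + (2 / q) * (?m / N powr q - 1)) \<le> N\<^sup>2 * (?m / N powr q) powr (2 / q)"
    using q m by (intro mult_left_mono Bernoulli_powr) auto
  also have "\<dots> = ?m powr (2 / q)"
    using N q m by (simp add: powr_divide powr_powr powr_numeral)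
  finally show ?thesis
    unfolding integral_gap[OF assms] using q by (simp add: Psi_def divide_right_mono)
qed

text \<open>
  Here \<open>N\<close> is the point of tangency itself.
\<close>

lemma (in prob_space) Psi_eq_integral_gap:
  fixes g :: "_ \<Rightarrow> real"
  assumes g[measurable]: "g \<in> borel_measurable M" and bd: "AE x in M. l \<le> g x \<and> g x \<le> C" and l: "0 < l"
    and p: "1 \<le> p" "p \<le> 2" and N: "0 < N" "N powr p = (\<integral>x. g x powr p \<partial>M)"
  shows "Psi p M g = N\<^sup>2 * (\<integral>x. gap p (g x / N) \<partial>M)"
proof (cases "p = 2")
  case False
  have "AE x in M. 0 \<le> g x \<and> g x \<le> C" using bd by eventually_elim (use l in auto)
  then have "N\<^sup>2 * (\<integral>x. gap p (g x / N) \<partial>M) = ((\<integral>x. (g x)\<^sup>2 \<partial>M) - N\<^sup>2) / (2 - p)"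
    using integral_gap[OF g, of C p N, folded N(2)] p False N(1) by simp
  moreover have "(N powr p) powr (2 / p) = N\<^sup>2"
    using p N(1) by (simp add: powr_powr powr_numeral)
  ultimately show ?thesis
    using False by (simp add: Psi_def N(2)[symmetric])
next
  case True
  have A: "(\<integral>x. (g x)\<^sup>2 \<partial>M) = N\<^sup>2"
  proof -
    have "(\<integral>x. g x powr p \<partial>M) = (\<integral>x. (g x)\<^sup>2 \<partial>M)"
      by (rule integral_cong_AE) (use bd l True in \<open>auto simp: powr_numeral elim!: eventually_mono\<close>)
    then show ?thesis using N True by (simp add: powr_numeral)
  qed
  have [simp]: "integrable M (\<lambda>x. (g x)\<^sup>2)"
    using g bd by (intro integrable_continuous_bounded[of g "\<lambda>y. y\<^sup>2" l C]) (auto intro!: continuous_intros)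
  have [simp]: "integrable M (\<lambda>x. (g x)\<^sup>2 * ln (g x))"
    using g bd l by (intro integrable_continuous_bounded[of g "\<lambda>y. y\<^sup>2 * ln y" l C])
      (auto intro!: continuous_intros)
  have "(\<integral>x. gap p (g x / N) \<partial>M) =
     (\<integral>x. ((g x)\<^sup>2 * ln (g x)) / N\<^sup>2 - (g x)\<^sup>2 * ((ln N + 1 / 2) / N\<^sup>2) + 1 / 2 \<partial>M)"
  proof (rule integral_cong_AE)
    show "AE x in M. gap p (g x / N) =
        ((g x)\<^sup>2 * ln (g x)) / N\<^sup>2 - (g x)\<^sup>2 * ((ln N + 1 / 2) / N\<^sup>2) + 1 / 2"
      using bd
    proof eventually_elim
      case (elim x)
      then have ln: "ln (g x / N) = ln (g x) - ln N" using l N by (simp add: ln_div)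
      show ?case unfolding gap_def ln using True N(1) by (simp add: power_divide field_simps)
    qed
  qed (auto simp: gap_def[abs_def])
  also have "\<dots> = (\<integral>x. (g x)\<^sup>2 * ln (g x) \<partial>M) / N\<^sup>2 - N\<^sup>2 * ((ln N + 1 / 2) / N\<^sup>2) + 1 / 2"
    by (simp add: prob_space A)
  also have "\<dots> = (\<integral>x. (g x)\<^sup>2 * ln (g x) \<partial>M) / N\<^sup>2 - ln N"
    using N by simp
  finally have "N\<^sup>2 * (\<integral>x. gap p (g x / N) \<partial>M) = (\<integral>x. (g x)\<^sup>2 * ln (g x) \<partial>M) - N\<^sup>2 * ln N"
    using N by (simp add: field_simps)
  moreover have "(\<integral>x. (g x)\<^sup>2 * ln ((g x)\<^sup>2) \<partial>M) = (\<integral>x. 2 * ((g x)\<^sup>2 * ln (g x)) \<partial>M)"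
    by (rule integral_cong_AE) (use bd l in \<open>auto simp: ln_realpow elim!: eventually_mono\<close>)
  ultimately show ?thesis
    using True N(1) by (simp add: Psi_def Ent_def A ln_realpow)
qed

section \<open>Comparison after a shift\<close>

text \<open>
  At \<open>c = 0\<close> the right-hand side is at least \<open>c\<close>. It is at most \<open>\<theta> (C + c)\<close>, which equals \<open>c\<close> at
  \<open>c = \<theta> C / (1 - \<theta>)\<close>, so equality holds in between.
\<close>

lemma (in prob_space) ex_shift_eq_Lp_norm:
  fixes f :: "_ \<Rightarrow> real"
  assumes [measurable]: "f \<in> borel_measurable M" and bd: "AE x in M. 0 \<le> f x \<and> f x \<le> C"
    and p: "1 \<le> p" and \<theta>: "0 \<le> \<theta>" "\<theta> < 1" and C: "0 \<le> C"
  shows "\<exists>c\<ge>0. c = \<theta> * (\<integral>x. (f x + c) powr p \<partial>M) powr (1 / p)"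
proof -
  define N where "N c = (\<integral>x. (f x + c) powr p \<partial>M) powr (1 / p)" for c
  define K where "K = \<theta> * C / (1 - \<theta>)"
  have K: "0 \<le> K" using \<theta> C by (simp add: K_def)
  have int: "integrable M (\<lambda>x. (f x + c) powr p)" if "0 \<le> c" for c
  proof (rule integrable_powr_bounded)
    show "AE x in M. 0 \<le> f x + c \<and> f x + c \<le> C + c"
      using bd by eventually_elim (use that in auto)
  qed (use p in auto)
  have cont: "continuous_on {0..K} (\<lambda>c. \<integral>x. (f x + c) powr p \<partial>M)"
    unfolding continuous_on_sequentially
  proof (intro allI ballI impI, elim conjE)
    fix u c assume c: "c \<in> {0..K}" and u: "\<forall>n. u n \<in> {0..K}" "u \<longlonglongrightarrow> c"
    show "((\<lambda>c. \<integral>x. (f x + c) powr p \<partial>M) \<circ> u) \<longlonglongrightarrow> (\<integral>x. (f x + c) powr p \<partial>M)"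
      unfolding comp_def
    proof (rule integral_dominated_convergence[where w = "\<lambda>x. (C + K) powr p"])
      show "AE x in M. (\<lambda>n. (f x + u n) powr p) \<longlonglongrightarrow> (f x + c) powr p"
        using bd
      proof eventually_elim
        case (elim x)
        then show ?case using u p c
          by (intro tendsto_powr' tendsto_intros) (auto intro!: always_eventually)
      qed
      show "AE x in M. norm ((f x + u n) powr p) \<le> (C + K) powr p" for n
        using bd
      proof eventually_elim
        case (elim x)
        then show ?case using u(1)[rule_format, of n] p by (auto intro!: powr_mono2)
      qed
    qed auto
  qed
  have "continuous_on {0..K} (\<lambda>c. \<theta> * N c - c)"
    unfolding N_def using p
    by (intro continuous_intros continuous_on_powr' cont) auto
  moreover have "\<theta> * N K - K \<le> 0"
  proof -
    have "(\<integral>x. (f x + K) powr p \<partial>M) \<le> (\<integral>x. (C + K) powr p \<partial>M)"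
    proof (intro integral_mono_AE int K)
      show "AE x in M. (f x + K) powr p \<le> (C + K) powr p"
        using bd by eventually_elim (use K p in \<open>auto intro!: powr_mono2\<close>)
    qed simp
    then have "N K \<le> ((C + K) powr p) powr (1 / p)"
      unfolding N_def using p by (intro powr_mono2) (auto simp: prob_space)
    then have "N K \<le> C + K" using p C K by (simp add: powr_powr)
    then have "\<theta> * N K \<le> \<theta> * (C + K)" using \<theta> by (intro mult_left_mono)
    also have "\<dots> = K" using \<theta> by (simp add: K_def field_simps)
    finally show ?thesis by simp
  qed
  moreover have "0 \<le> \<theta> * N 0 - 0" using \<theta> by (simp add: N_def)
  ultimately obtain c where "0 \<le> c" "c \<le> K" "\<theta> * N c - c = 0"
    using IVT2'[of "\<lambda>c. \<theta> * N c - c" K 0 0] K by auto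
  then show ?thesis unfolding N_def by (intro exI[of _ c]) auto
qed

lemma (in prob_space) Psi_le_Psi_shift:
  fixes f :: "_ \<Rightarrow> real"
  assumes f[measurable]: "f \<in> borel_measurable M" and bd: "AE x in M. 0 \<le> f x \<and> f x \<le> C"
    and q: "1 < q" and qp: "q < p" and p: "p \<le> 2"
    and nz: "\<not> (AE x in M. f x = 0)"
  shows "\<exists>c\<ge>0. Psi q M f \<le> Psi p M (\<lambda>x. f x + c)"
proof -
  define a where "a = (q - 1) / (p - 1)"
  have a: "0 < a" "a < 1" using q qp by (auto simp: a_def)
  have "AE x in M. 0 \<le> C" using bd by eventually_elim auto
  then have C: "0 \<le> C" by simp
  obtain c where c: "0 \<le> c" "c = (1 - a) * (\<integral>x. (f x + c) powr p \<partial>M) powr (1 / p)"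
    using ex_shift_eq_Lp_norm[OF f bd, of p "1 - a"] a q qp C by auto
  define m where "m = (\<integral>x. (f x + c) powr p \<partial>M)"
  define N where "N = m powr (1 / p)"
  have cN: "c = (1 - a) * N" using c(2) by (simp add: N_def m_def)
  have bdc: "AE x in M. c \<le> f x + c \<and> f x + c \<le> C + c"
    using bd by eventually_elim auto
  have "0 \<le> m" by (simp add: m_def)
  have "m \<noteq> 0"
  proof
    assume "m = 0"
    then have "c = 0" using cN by (simp add: N_def)
    moreover have "integrable M (\<lambda>x. f x powr p)"
      using integrable_powr_bounded[OF f bd] q qp by simp
    ultimately have "AE x in M. f x powr p = 0"
      using \<open>m = 0\<close> integral_nonneg_eq_0_iff_AE[of M "\<lambda>x. f x powr p"] by (simp add: m_def)
    then show False using nz by simp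
  qed
  then have N: "0 < N" "N powr p = m"
    using \<open>0 \<le> m\<close> q qp by (auto simp: N_def powr_powr)
  have c_pos: "0 < c" using cN a N by simp
  let ?z = "\<lambda>x. f x / (a * N)"
  have "Psi q M f \<le> (a * N)\<^sup>2 * (\<integral>x. gap q (?z x) \<partial>M)"
    using Psi_le_integral_gap[OF f bd] q qp p a N by simp
  also have "\<dots> = N\<^sup>2 * (\<integral>x. a\<^sup>2 * gap q (?z x) \<partial>M)"
    by (simp add: power_mult_distrib)
  also have "\<dots> \<le> N\<^sup>2 * (\<integral>x. gap p ((f x + c) / N) \<partial>M)"
  proof (intro mult_left_mono integral_mono_AE)
    have aN: "0 < a * N" using a N by simp
    have "integrable M (\<lambda>x. gap q (?z x))"
    proof (rule integrable_continuous_bounded[where h = "gap q" and f = "?z" and l = 0 and C = "C / (a * N)"])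
      show "continuous_on {0..C / (a * N)} (gap q)"
        by (rule continuous_on_subset[OF continuous_on_gap[of q 0]]) (use q qp p in auto)
      show "AE x in M. 0 \<le> ?z x \<and> ?z x \<le> C / (a * N)"
        using bd by eventually_elim (use aN in \<open>auto simp: divide_right_mono\<close>)
    qed (auto simp: gap_def[abs_def])
    then show "integrable M (\<lambda>x. a\<^sup>2 * gap q (?z x))" by simp
    show "integrable M (\<lambda>x. gap p ((f x + c) / N))"
    proof (rule integrable_continuous_bounded[where h = "gap p" and f = "\<lambda>x. (f x + c) / N"
          and l = "c / N" and C = "(C + c) / N"])
      show "continuous_on {c / N..(C + c) / N} (gap p)"
        by (rule continuous_on_subset[OF continuous_on_gap[of p "c / N"]]) (use c_pos N q qp p in auto)
      show "AE x in M. c / N \<le> (f x + c) / N \<and> (f x + c) / N \<le> (C + c) / N"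
        using bdc by eventually_elim (use N in \<open>auto simp: divide_right_mono\<close>)
    qed (auto simp: gap_def[abs_def])
    show "AE x in M. a\<^sup>2 * gap q (?z x) \<le> gap p ((f x + c) / N)"
      using bd
    proof eventually_elim
      case (elim x)
      have "1 - a + a * ?z x = (f x + c) / N"
        using a N by (simp add: cN field_simps)
      moreover have "0 \<le> ?z x" using elim aN by simp
      ultimately show ?case
        using gap_comparison[OF q qp p, of "?z x", folded a_def] by simp
    qed
  qed simp
  also have "\<dots> = Psi p M (\<lambda>x. f x + c)"
    using Psi_eq_integral_gap[OF _ bdc c_pos, of p N] q qp p N by (simp add: m_def)
  finally show ?thesis using c(1) by blast
qed

text \<open>
  Excluding \<open>f = 0\<close> almost everywhere keeps the base of the outer power away from \<open>0\<close>.
\<close>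

lemma (in prob_space) Psi_tendsto_Psi_one:
  fixes f :: "_ \<Rightarrow> real" and q :: "nat \<Rightarrow> real"
  assumes f[measurable]: "f \<in> borel_measurable M" and bd: "AE x in M. 0 \<le> f x \<and> f x \<le> C"
    and nz: "\<not> (AE x in M. f x = 0)"
    and q: "\<And>n. 1 < q n" "\<And>n. q n < 2" "q \<longlonglongrightarrow> 1"
  shows "(\<lambda>n. Psi (q n) M f) \<longlonglongrightarrow> Psi 1 M f"
proof -
  have lim: "(\<lambda>n. \<integral>x. f x powr q n \<partial>M) \<longlonglongrightarrow> (\<integral>x. f x powr 1 \<partial>M)"
  proof (rule integral_dominated_convergence[where w = "\<lambda>x. (1 + C)\<^sup>2"])
    show "AE x in M. (\<lambda>n. f x powr q n) \<longlonglongrightarrow> f x powr 1"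
      using bd by eventually_elim (intro tendsto_powr' tendsto_intros q, auto)
    show "AE x in M. norm (f x powr q n) \<le> (1 + C)\<^sup>2" for n
      using bd
    proof eventually_elim
      case (elim x)
      have "f x powr q n \<le> (1 + C) powr q n"
        using elim q(1)[of n] by (intro powr_mono2) auto
      also have "\<dots> \<le> (1 + C) powr 2"
        using elim q(2)[of n] by (intro powr_mono) auto
      finally show ?case using elim by (simp add: powr_numeral)
    qed
  qed auto
  have "\<not> (AE x in M. f x powr 1 = 0)" using nz by simp
  then have "(\<integral>x. f x powr 1 \<partial>M) \<noteq> 0"
    using integral_nonneg_eq_0_iff_AE[of M "\<lambda>x. f x powr 1"] integrable_powr_bounded[OF f bd, of 1]
    by simp
  then have "(\<lambda>n. ((\<integral>x. (f x)\<^sup>2 \<partial>M) - (\<integral>x. f x powr q n \<partial>M) powr (2 / q n)) / (2 - q n))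
      \<longlonglongrightarrow> ((\<integral>x. (f x)\<^sup>2 \<partial>M) - (\<integral>x. f x powr 1 \<partial>M) powr (2 / 1)) / (2 - 1)"
    by (intro tendsto_intros lim q) auto
  moreover have "q n \<noteq> 2" for n using q(2)[of n] by simp
  ultimately show ?thesis by (simp add: Psi_def)
qed

section \<open>Invariance under constant shifts\<close>

lemma (in prob_space) Osc_add_const:
  assumes [measurable]: "f \<in> borel_measurable M"
  shows "Osc M (\<lambda>x. f x + c) = Osc M f"
proof -
  have ne: "ae_filter M \<noteq> bot"
    by (simp add: ae_filter_eq_bot_iff emeasure_space_1)
  have shift: "esssup M (\<lambda>x. ereal (h x + d)) = esssup M (\<lambda>x. ereal (h x)) + ereal d"
    if "h \<in> borel_measurable M" for h d
    using that Limsup_add_ereal_right[OF ne, of "ereal d" "\<lambda>x. ereal (h x)"]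
    by (simp add: esssup_def)
  have cancel: "(S + ereal c) + (I + ereal (- c)) = S + I" for S I :: ereal
    by (cases S; cases I) auto
  show ?thesis
    using shift[of f c] shift[of "\<lambda>x. - f x" "- c"] cancel[of "esssup M f" "esssup M (\<lambda>x. - f x)"]
    by (simp add: Osc_def essinf_def)
qed

context conservative_symmetric_Dirichlet_form
begin

lemma const_in_dom: "(\<lambda>x. c) \<in> D"
  using dom_scale[OF one_in_dom, of c] by simp

lemma form_shift:
  assumes f: "f \<in> D"
  shows "E (\<lambda>x. f x + t) (\<lambda>x. f x + t) = E f f + 2 * t * E f (\<lambda>x. 1)"
proof -
  have c: "E (\<lambda>x. t) h = t * E (\<lambda>x. 1) h" if "h \<in> D" for h
    using form_scale[OF one_in_dom that, of t] by simp
  have ft: "(\<lambda>x. f x + t) \<in> D" by (intro dom_add f const_in_dom)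
  have "E (\<lambda>x. f x + t) (\<lambda>x. f x + t) = E f (\<lambda>x. f x + t) + t * E (\<lambda>x. 1) (\<lambda>x. f x + t)"
    using form_add[OF f const_in_dom[of t] ft] c[OF ft] by simp
  moreover have "E f (\<lambda>x. f x + t) = E f f + t * E f (\<lambda>x. 1)"
    using form_sym[OF f ft] form_add[OF f const_in_dom[of t] f] c[OF f] form_sym[OF one_in_dom f] by simp
  moreover have "E (\<lambda>x. 1) (\<lambda>x. f x + t) = E f (\<lambda>x. 1)"
    using form_sym[OF one_in_dom ft] form_add[OF f const_in_dom[of t] one_in_dom]
      c[OF one_in_dom] form_one by simp
  ultimately show ?thesis by simp
qed

text \<open>
  By \<open>form_shift\<close>, \<open>E(f + t, f + t)\<close> is affine in \<open>t\<close>, and it is non-negative for all real \<open>t\<close>;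
  hence its slope vanishes.
\<close>

lemma form_one_right:
  assumes f: "f \<in> D"
  shows "E f (\<lambda>x. 1) = 0"
proof (rule ccontr)
  assume nz: "E f (\<lambda>x. 1) \<noteq> 0"
  \<comment> \<open>the point at which the affine function takes the value \<open>- 1\<close>\<close>
  define t where "t = - (E f f + 1) / (2 * E f (\<lambda>x. 1))"
  have "0 \<le> E (\<lambda>x. f x + t) (\<lambda>x. f x + t)"
    by (intro form_nonneg dom_add f const_in_dom)
  also have "\<dots> = E f f + 2 * t * E f (\<lambda>x. 1)"
    by (rule form_shift[OF f])
  also have "\<dots> = - 1" using nz by (simp add: t_def field_simps)
  finally show False by simp
qed

lemma form_add_const: "f \<in> D \<Longrightarrow> E (\<lambda>x. f x + c) (\<lambda>x. f x + c) = E f f"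
  by (simp add: form_shift form_one_right)

end

theorem theorem1p3:
  fixes M :: "'a measure"
    and D :: "('a \<Rightarrow> real) set"
    and E :: "('a \<Rightarrow> real) \<Rightarrow> ('a \<Rightarrow> real) \<Rightarrow> real"
    and p :: real
    and \<beta> :: "real \<Rightarrow> real"
  assumes "prob_space M"
    and "conservative_symmetric_Dirichlet_form M D E"
    and "1 \<le> p" and "p \<le> 2"
    and "\<And>r. r > 0 \<Longrightarrow> \<beta> r \<ge> 0"
    and "\<And>f r. f \<in> D \<Longrightarrow> ess_bounded M f \<Longrightarrow> (AE x in M. f x \<ge> 0) \<Longrightarrow> r > 0 \<Longrightarrow>
           Psi p M f \<le> \<beta> r * E f f + r * (Osc M f)\<^sup>2"
  shows "\<forall>q. 1 \<le> q \<and> q \<le> p \<longrightarrow>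
           (\<forall>f\<in>D. ess_bounded M f \<and> (AE x in M. f x \<ge> 0) \<longrightarrow>
             (\<forall>r>0. Psi q M f \<le> \<beta> r * E f f + r * (Osc M f)\<^sup>2))"
proof (intro allI impI ballI, elim conjE)
  fix q f r
  assume q: "1 \<le> q" "q \<le> p" and f: "f \<in> D" and "ess_bounded M f"
    and nn: "AE x in M. f x \<ge> 0" and r: "0 < (r::real)"
  interpret prob_space M by fact
  interpret conservative_symmetric_Dirichlet_form M D E by fact
  have fm: "f \<in> borel_measurable M" using f dom_L2 by (auto simp: L2_space_def)
  from \<open>ess_bounded M f\<close> obtain C where "AE x in M. \<bar>f x\<bar> \<le> C"
    by (auto simp: ess_bounded_def)
  with nn have bd: "AE x in M. 0 \<le> f x \<and> f x \<le> C" by eventually_elim auto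
  let ?R = "\<beta> r * E f f + r * (Osc M f)\<^sup>2"
  have shifted: "Psi p M (\<lambda>x. f x + c) \<le> ?R" if "0 \<le> c" for c
  proof -
    have "AE x in M. \<bar>f x + c\<bar> \<le> C + c" "AE x in M. 0 \<le> f x + c"
      using bd by (eventually_elim, use that in auto)+
    then show ?thesis
      using assms(6)[of "\<lambda>x. f x + c" r] dom_add[OF f const_in_dom, of c] r
      by (auto simp: ess_bounded_def form_add_const f Osc_add_const fm)
  qed
  have R: "0 \<le> ?R" using assms(5) r form_nonneg[OF f] by simp
  show "Psi q M f \<le> ?R"
  proof (cases "q = p \<or> (AE x in M. f x = 0)")
    case True
    then show ?thesis
    proof
      assume "q = p"
      then show ?thesis using shifted[of 0] by simp
    next
      assume ae: "AE x in M. f x = 0"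
      have "(\<integral>x. (f x)\<^sup>2 \<partial>M) = 0" "(\<integral>x. f x powr q \<partial>M) = 0"
        "(\<integral>x. (f x)\<^sup>2 * ln ((f x)\<^sup>2) \<partial>M) = 0"
        using ae by (auto intro!: integral_eq_zero_AE elim!: eventually_mono)
      then show ?thesis using R by (simp add: Psi_def Ent_def)
    qed
  next
    case False
    then have qp: "q < p" and nz: "\<not> (AE x in M. f x = 0)" using q by auto
    have above_one: "Psi s M f \<le> ?R" if s: "1 < s" "s < p" for s
      using Psi_le_Psi_shift[OF fm bd s \<open>p \<le> 2\<close> nz] shifted by force
    show ?thesis
    proof (cases "q = 1")
      case False
      then show ?thesis using above_one q qp by simp
    next
      case True
      define s where "s n = 1 + (p - 1) * inverse (real (Suc (Suc n)))" for n
      have s: "1 < s n" "s n < p" for n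
      proof -
        have "inverse (real (Suc (Suc n))) < 1" by (subst inverse_less_1_iff) auto
        then have "0 < (p - 1) * (1 - inverse (real (Suc (Suc n))))"
          using qp True by (intro mult_pos_pos) auto
        also have "\<dots> = p - s n" by (simp only: s_def right_diff_distrib) simp
        finally show "s n < p" by simp
        show "1 < s n" using qp True by (simp add: s_def)
      qed
      have "s \<longlonglongrightarrow> 1 + (p - 1) * 0"
        unfolding s_def by (intro tendsto_intros LIMSEQ_Suc[OF LIMSEQ_inverse_real_of_nat])
      then have "(\<lambda>n. Psi (s n) M f) \<longlonglongrightarrow> Psi 1 M f"
        using s \<open>p \<le> 2\<close> by (intro Psi_tendsto_Psi_one[OF fm bd nz]) (auto intro: less_le_trans)
      then show ?thesis
        using True above_one[OF s] by (auto intro: LIMSEQ_le_const2)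
    qed
  qed
qed

end
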